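(* For any Boolean algebra $\mathbb{A}$ and any topological space $X$: 1. $UV(\mathbb{A})$ is a UV-space; 2. $X$ is homeomorphic to $UV(\mathsf{CO}\mathcal{RO}(X))$ if and only if $X$ is a UV-space.
   Context: The base theory is ZF (no choice principles). For a Boolean algebra $\mathbb{A}$, $UV(\mathbb{A})$ is the space whose points are the proper filters of $\mathbb{A}$ and whose topology is generated by the sets $\widehat{a}=\{F \mid F \text{ a proper filter of } \mathbb{A},\ a\in F\}$, $a\in\mathbb{A}$. For a topological space $X$, its specialization order is: $x\leqslant y$ iff every open set containing $x$ contains $y$. For $U\subseteq X$, put $\mathsf{cl}_\leqslant(U)=\{x\in X\mid \exists y\in X: x\leqslant y,\ y\in U\}$ and $\mathsf{int}_\leqslant(U)=\{x\in X\mid \forall y\in X:\ x\leqslant y\Rightarrow y\in U\}$. $\mathcal{RO}(X)$ is the collection of sets $U\subseteq X$ with $U=\mathsf{int}_\leqslant(\mathsf{cl}_\leqslant(U))$ (the regular open sets of the topology of $\leqslant$-upsets). $\mathsf{CO}\mathcal{RO}(X)$ is the collection of subsets of $X$ that are compact and open in $X$ and belong to $\mathcal{RO}(X)$; for $x\in X$, $\mathsf{CO}\mathcal{RO}(x)=\{U\in\mathsf{CO}\mathcal{RO}(X)\mid x\in U\}$. A UV-space is a $T_0$ space $X$ such that (i) $\mathsf{CO}\mathcal{RO}(X)$ is closed under binary intersection and under $U\mapsto \mathsf{int}_\leqslant(X\setminus U)$ and is a basis for $X$; and (ii) every proper filter in $\mathsf{CO}\mathcal{RO}(X)$ (ordered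 by inclusion) is $\mathsf{CO}\mathcal{RO}(x)$ for some $x\in X$. When $X$ is a UV-space, $\mathsf{CO}\mathcal{RO}(X)$ is a Boolean algebra under inclusion, with meet $\cap$ and complement $U\mapsto\mathsf{int}_\leqslant(X\setminus U)$; the left-hand side of part 2 is understood to include that $\mathsf{CO}\mathcal{RO}(X)$ ordered by inclusion is a Boolean algebra. *)

theory Defs
  imports "HOL-Analysis.Analysis" "HOL-Algebra.Lattice"
begin

subsection \<open>Boolean algebras with a carrier set, their filters, and the space UV\<close>

text \<open>A Boolean algebra is a bounded distributive complemented lattice on a carrier set. The
  one-element algebra is admitted; it has no proper filters, so its UV is the empty space.\<close>

locale boolean_lattice = bounded_lattice +
  assumes meet_join_distrib:
      "\<lbrakk>x \<in> carrier L; y \<in> carrier L; z \<in> carrier L\<rbrakk>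
        \<Longrightarrow> x \<sqinter> (y \<squnion> z) = (x \<sqinter> y) \<squnion> (x \<sqinter> z)"
    and complement_exists:
      "x \<in> carrier L \<Longrightarrow> \<exists>y\<in>carrier L. x \<sqinter> y = \<bottom> \<and> x \<squnion> y = \<top>"

definition proper_filter :: "('a, 'm) gorder_scheme \<Rightarrow> 'a set \<Rightarrow> bool" where
  "proper_filter L F \<longleftrightarrow>
     F \<subseteq> carrier L \<and> F \<noteq> {} \<and> F \<noteq> carrier L \<and>
     (\<forall>x\<in>F. \<forall>y\<in>carrier L. x \<sqsubseteq>\<^bsub>L\<^esub> y \<longrightarrow> y \<in> F) \<and>
     (\<forall>x\<in>F. \<forall>y\<in>F. x \<sqinter>\<^bsub>L\<^esub> y \<in> F)"

definition hat :: "('a, 'm) gorder_scheme \<Rightarrow> 'a \<Rightarrow> 'a set set" where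
  "hat L a = {F. proper_filter L F \<and> a \<in> F}"

definition UV :: "('a, 'm) gorder_scheme \<Rightarrow> 'a set topology" where
  "UV L = topology_generated_by (hat L ` carrier L)"

text \<open>The points of UV are all proper filters: filters are nonempty, so the generating sets
  cover them.\<close>

lemma topspace_UV: "topspace (UV L) = {F. proper_filter L F}"
  by (auto simp: UV_def hat_def proper_filter_def)


subsection \<open>Specialization order and compact open regular open sets\<close>

definition spec_le :: "'a topology \<Rightarrow> 'a \<Rightarrow> 'a \<Rightarrow> bool" where
  "spec_le X x y \<longleftrightarrow> (\<forall>U. openin X U \<and> x \<in> U \<longrightarrow> y \<in> U)"

definition cl_spec :: "'a topology \<Rightarrow> 'a set \<Rightarrow> 'a set" where
  "cl_spec X U = {x \<in> topspace X. \<exists>y\<in>topspace X. spec_le X x y \<and> y \<in> U}"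

definition int_spec :: "'a topology \<Rightarrow> 'a set \<Rightarrow> 'a set" where
  "int_spec X U = {x \<in> topspace X. \<forall>y\<in>topspace X. spec_le X x y \<longrightarrow> y \<in> U}"

definition RO :: "'a topology \<Rightarrow> 'a set set" where
  "RO X = {U. U \<subseteq> topspace X \<and> U = int_spec X (cl_spec X U)}"

definition CORO :: "'a topology \<Rightarrow> 'a set set" where
  "CORO X = {U. compactin X U \<and> openin X U \<and> U \<in> RO X}"

definition CORO_at :: "'a topology \<Rightarrow> 'a \<Rightarrow> 'a set set" where
  "CORO_at X x = {U \<in> CORO X. x \<in> U}"

definition CORO_order :: "'a topology \<Rightarrow> 'a set gorder" where
  "CORO_order X = \<lparr>carrier = CORO X, eq = (=), le = (\<subseteq>)\<rparr>"


subsection \<open>UV-spaces\<close>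

definition UV_space :: "'a topology \<Rightarrow> bool" where
  "UV_space X \<longleftrightarrow>
     t0_space X \<and>
     (\<forall>U\<in>CORO X. \<forall>V\<in>CORO X. U \<inter> V \<in> CORO X) \<and>
     (\<forall>U\<in>CORO X. int_spec X (topspace X - U) \<in> CORO X) \<and>
     openin X = arbitrary union_of (\<lambda>U. U \<in> CORO X) \<and>
     (\<forall>F. proper_filter (CORO_order X) F \<longrightarrow> (\<exists>x\<in>topspace X. F = CORO_at X x))"

text \<open>The filters in the last clause of \<open>UV_space\<close> use the lattice meet of \<open>CORO_order X\<close>; given
  the other clauses, that meet is intersection.\<close>

lemma meet_CORO_order:
  assumes "U \<in> CORO X" "V \<in> CORO X" "U \<inter> V \<in> CORO X"
  shows "U \<sqinter>\<^bsub>CORO_order X\<^esub> V = U \<inter> V"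
  unfolding meet_def inf_def
proof (rule some_equality)
  have car: "carrier (CORO_order X) = CORO X" and le: "\<And>S T. (S \<sqsubseteq>\<^bsub>CORO_order X\<^esub> T) = (S \<subseteq> T)"
    by (simp_all add: CORO_order_def)
  have low: "Lower (CORO_order X) {U, V} = {W \<in> CORO X. W \<subseteq> U \<and> W \<subseteq> V}"
    using assms(1,2) unfolding Lower_def car le by blast
  show "greatest (CORO_order X) (U \<inter> V) (Lower (CORO_order X) {U, V})"
    unfolding greatest_def low car le using assms(3) by blast
  fix W assume W: "greatest (CORO_order X) W (Lower (CORO_order X) {U, V})"
  have "U \<inter> V \<subseteq> W"
    using W assms(3) by (simp add: greatest_def low le)
  moreover have "W \<subseteq> U \<inter> V"
    using W by (simp add: greatest_def low)
  ultimately show "W = U \<inter> V"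
    by (rule equalityI[rotated])
qed

end

theory Submission
  imports Defs
begin

text \<open>The dual of an element \<open>a\<close> is the set of points whose filter contains \<open>a\<close>. Such a set is
  compact for a trivial reason: if nonempty, it has a least point in the specialization order, namely
  the principal filter of \<open>a\<close>. Conversely, a compact open set is a finite union of duals, and if it
  is moreover regular open it equals its double negation, which by De Morgan is the dual of a single
  element. So the compact open regular open sets are exactly the duals, and the filter condition
  follows. These arguments use only a homeomorphism with \<open>UV L\<close>, which also gives the
  invariance under homeomorphism needed in part 2. For the converse in part 2, the homeomorphism
  is \<open>x \<mapsto> CORO_at X x\<close>.\<close>

subsection \<open>Proper filters of a Boolean lattice\<close>

context boolean_lattice
begin

lemma proper_filter_iff_bottom_notin:
  assumes "F \<subseteq> carrier L" "\<And>x y. \<lbrakk>x \<in> F; y \<in> carrier L; x \<sqsubseteq> y\<rbrakk> \<Longrightarrow> y \<in> F"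
  shows "F \<noteq> carrier L \<longleftrightarrow> \<bottom> \<notin> F"
  using assms by (metis bottom_closed bottom_lower subsetI subset_antisym)

lemma proper_filterI:
  assumes "F \<subseteq> carrier L" "F \<noteq> {}" "\<bottom> \<notin> F"
    and "\<And>x y. \<lbrakk>x \<in> F; y \<in> carrier L; x \<sqsubseteq> y\<rbrakk> \<Longrightarrow> y \<in> F"
    and "\<And>x y. \<lbrakk>x \<in> F; y \<in> F\<rbrakk> \<Longrightarrow> x \<sqinter> y \<in> F"
  shows "proper_filter L F"
  using assms unfolding proper_filter_def by (metis bottom_closed)

lemma proper_filter_subset: "proper_filter L F \<Longrightarrow> F \<subseteq> carrier L"
  by (simp add: proper_filter_def)

lemma proper_filter_up: "\<lbrakk>proper_filter L F; x \<in> F; y \<in> carrier L; x \<sqsubseteq> y\<rbrakk> \<Longrightarrow> y \<in> F"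
  by (simp add: proper_filter_def)

lemma proper_filter_meet_iff:
  assumes "proper_filter L F" "a \<in> carrier L" "b \<in> carrier L"
  shows "a \<sqinter> b \<in> F \<longleftrightarrow> a \<in> F \<and> b \<in> F"
  using assms
  by (metis meet_closed meet_left meet_right proper_filter_def)

lemma proper_filter_bottom: "proper_filter L F \<Longrightarrow> \<bottom> \<notin> F"
  using proper_filter_iff_bottom_notin by (metis proper_filter_def)

lemma proper_filter_top: "proper_filter L F \<Longrightarrow> \<top> \<in> F"
  unfolding proper_filter_def by (metis all_not_in_conv subsetD top_closed top_higher)

text \<open>Provides the least point of the set dual to \<open>a\<close>, on which compactness
  rests.\<close>

lemma proper_filter_principal:
  assumes "a \<in> carrier L" "a \<noteq> \<bottom>"
  shows "proper_filter L {c \<in> carrier L. a \<sqsubseteq> c}"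
proof (rule proper_filterI)
  show "\<bottom> \<notin> {c \<in> carrier L. a \<sqsubseteq> c}"
    using assms by (auto simp: le_antisym)
  show "y \<in> {c \<in> carrier L. a \<sqsubseteq> c}"
    if "x \<in> {c \<in> carrier L. a \<sqsubseteq> c}" "y \<in> carrier L" "x \<sqsubseteq> y" for x y
    using that assms le_trans by blast
  show "x \<sqinter> y \<in> {c \<in> carrier L. a \<sqsubseteq> c}"
    if "x \<in> {c \<in> carrier L. a \<sqsubseteq> c}" "y \<in> {c \<in> carrier L. a \<sqsubseteq> c}" for x y
    using that assms by (simp add: meet_le)
qed (use assms in auto)

text \<open>Write \<open>b\<close> as \<open>b \<sqinter> (a \<squnion> c)\<close>; by
  distributivity only \<open>b \<sqinter> c\<close> survives.\<close>

lemma le_if_meet_bottom: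
  assumes "a \<in> carrier L" "b \<in> carrier L" "c \<in> carrier L" "b \<sqinter> a = \<bottom>" "a \<squnion> c = \<top>"
  shows "b \<sqsubseteq> c"
proof -
  have "b = b \<sqinter> (a \<squnion> c)"
    using assms by (metis le_antisym le_refl meet_closed meet_le meet_left top_closed top_higher)
  also have "\<dots> = b \<sqinter> c"
    using assms by (metis (no_types, lifting) bottom_closed bottom_lower join_closed join_le join_right
        le_antisym le_refl meet_closed meet_join_distrib)
  finally show ?thesis
    using assms by (metis meet_right)
qed

text \<open>The filter generated by \<open>F\<close> and \<open>a\<close> is proper: if
  \<open>b \<sqinter> a\<close> were bottom for some \<open>b\<close> in \<open>F\<close>, then
  \<open>b\<close> would lie below \<open>c\<close>, forcing \<open>c\<close> into \<open>F\<close>.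
  It is used to find a point above \<open>F\<close> in the dual of \<open>a\<close>.\<close>

lemma proper_filter_extend:
  assumes F: "proper_filter L F" and a: "a \<in> carrier L" and c: "c \<in> carrier L"
    and join: "a \<squnion> c = \<top>" and "c \<notin> F"
  obtains G where "proper_filter L G" "F \<subseteq> G" "a \<in> G"
proof
  let ?G = "{d \<in> carrier L. \<exists>b\<in>F. b \<sqinter> a \<sqsubseteq> d}"
  note car = subsetD[OF proper_filter_subset[OF F]]
  show "F \<subseteq> ?G"
    using a car meet_left by blast
  show "a \<in> ?G"
    using a car meet_right proper_filter_top[OF F] by blast
  show "proper_filter L ?G"
  proof (rule proper_filterI)
    show "?G \<noteq> {}"
      using \<open>a \<in> ?G\<close> by blast
    show "\<bottom> \<notin> ?G"
    proof
      assume "\<bottom> \<in> ?G"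
      then obtain b where b: "b \<in> F" "b \<sqinter> a = \<bottom>"
        using a car by (auto simp: le_antisym)
      then have "b \<sqsubseteq> c"
        using a c join car le_if_meet_bottom by blast
      then show False
        using proper_filter_up[OF F] b c \<open>c \<notin> F\<close> by blast
    qed
    show "y \<in> ?G" if xy: "x \<in> ?G" "y \<in> carrier L" "x \<sqsubseteq> y" for x y
    proof -
      obtain b where b: "b \<in> F" "b \<sqinter> a \<sqsubseteq> x" "x \<in> carrier L"
        using xy(1) by blast
      then have "b \<sqinter> a \<sqsubseteq> y"
        using xy(2,3) a car[of b] le_trans[of "b \<sqinter> a" x y] by simp
      then show ?thesis
        using b(1) xy(2) by blast
    qed
    show "x \<sqinter> y \<in> ?G" if xy: "x \<in> ?G" "y \<in> ?G" for x y
    proof -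
      obtain b d where b: "b \<in> F" "b \<sqinter> a \<sqsubseteq> x" and d: "d \<in> F" "d \<sqinter> a \<sqsubseteq> y"
        using xy by blast
      have cl: "x \<in> carrier L" "y \<in> carrier L" "b \<in> carrier L" "d \<in> carrier L"
        using xy b d car by auto
      \<comment> \<open>Combining the two witnesses gives a single element of the required form that
        lies below both \<open>b \<sqinter> a\<close> and \<open>d \<sqinter> a\<close>.\<close>
      let ?m = "(b \<sqinter> d) \<sqinter> a"
      have m: "?m \<sqsubseteq> b" "?m \<sqsubseteq> d" "?m \<sqsubseteq> a"
        using cl a le_trans[of ?m "b \<sqinter> d" b] le_trans[of ?m "b \<sqinter> d" d]
        by (simp_all add: meet_left meet_right)
      have "?m \<sqsubseteq> b \<sqinter> a" "?m \<sqsubseteq> d \<sqinter> a"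
        using cl a m by (simp_all add: meet_le)
      then have "?m \<sqsubseteq> x" "?m \<sqsubseteq> y"
        using cl a b d le_trans[of ?m "b \<sqinter> a" x] le_trans[of ?m "d \<sqinter> a" y] by simp_all
      then have "?m \<sqsubseteq> x \<sqinter> y"
        using cl a by (simp add: meet_le)
      moreover have "b \<sqinter> d \<in> F"
        using F b d cl by (simp add: proper_filter_meet_iff)
      ultimately show ?thesis
        using cl by auto
    qed
  qed auto
qed

text \<open>The generating sets are a basis and not merely a subbasis, because
  \<open>hat L a \<inter> hat L b\<close> is \<open>hat L (a \<sqinter> b)\<close>. This settles the
  intersection case of the induction over the generated topology.\<close>

lemma openin_UV_iff:
  "openin (UV L) W \<longleftrightarrow> (\<forall>F\<in>W. \<exists>a\<in>carrier L. F \<in> hat L a \<and> hat L a \<subseteq> W)"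
proof -
  have "\<forall>F\<in>W. \<exists>a\<in>carrier L. F \<in> hat L a \<and> hat L a \<subseteq> W"
    if "generate_topology_on (hat L ` carrier L) W"
    using that
  proof induction
    case (Int U V)
    show ?case
    proof
      fix F assume "F \<in> U \<inter> V"
      then obtain a b where ab: "a \<in> carrier L" "b \<in> carrier L" "F \<in> hat L a" "F \<in> hat L b"
        "hat L a \<subseteq> U" "hat L b \<subseteq> V"
        using Int by blast
      then have "hat L (a \<sqinter> b) = hat L a \<inter> hat L b"
        unfolding hat_def by (auto simp: proper_filter_meet_iff)
      then show "\<exists>a\<in>carrier L. F \<in> hat L a \<and> hat L a \<subseteq> U \<inter> V"
        using ab by (intro bexI[of _ "a \<sqinter> b"]) auto
    qed
  next
    case (UN K)
    then show ?case
      by (meson Union_iff Union_upper order_trans)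
  qed auto
  moreover have "openin (UV L) W"
    if "\<forall>F\<in>W. \<exists>a\<in>carrier L. F \<in> hat L a \<and> hat L a \<subseteq> W"
  proof -
    have "openin (UV L) (hat L a)" if "a \<in> carrier L" for a
      unfolding UV_def using that by (intro topology_generated_by_Basis) blast
    then show ?thesis
      using that by (subst openin_subopen) blast
  qed
  ultimately show ?thesis
    unfolding UV_def openin_topology_generated_by_iff by (rule iffI)
qed

end


subsection \<open>Regular open sets of the specialization order\<close>

lemma spec_le_refl: "spec_le X x x"
  by (simp add: spec_le_def)

lemma spec_le_trans: "\<lbrakk>spec_le X x y; spec_le X y z\<rbrakk> \<Longrightarrow> spec_le X x z"
  by (simp add: spec_le_def)

lemma openin_spec_le: "\<lbrakk>openin X U; x \<in> U; spec_le X x y\<rbrakk> \<Longrightarrow> y \<in> U"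
  by (auto simp: spec_le_def)

lemma int_spec_subset: "int_spec X U \<subseteq> topspace X"
  by (auto simp: int_spec_def)

text \<open>Call \<open>int_spec X (topspace X - U)\<close> the pseudocomplement of
  \<open>U\<close>. Regular open then means equal to the double pseudocomplement, a form to which De
  Morgan applies.\<close>

lemma int_spec_cl_spec:
  "int_spec X (cl_spec X U) = int_spec X (topspace X - int_spec X (topspace X - U))"
  by (auto simp: int_spec_def cl_spec_def)

text \<open>The pointwise reading of double negation: \<open>U\<close> is dense above
  \<open>x\<close> in the specialization order.\<close>

lemma int_cl_spec_iff:
  "x \<in> int_spec X (cl_spec X U) \<longleftrightarrow> x \<in> topspace X \<and>
     (\<forall>y\<in>topspace X. spec_le X x y \<longrightarrow> (\<exists>z\<in>topspace X. spec_le X y z \<and> z \<in> U))"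
  by (auto simp: int_spec_def cl_spec_def)

text \<open>Open sets are upsets of the specialization order, so each \<open>y\<close> above a point
  of \<open>U\<close> is its own witness for density.\<close>

lemma openin_subset_int_cl_spec:
  assumes "openin X U"
  shows "U \<subseteq> int_spec X (cl_spec X U)"
proof
  fix x assume "x \<in> U"
  then show "x \<in> int_spec X (cl_spec X U)"
    using openin_subset[OF assms] openin_spec_le[OF assms \<open>x \<in> U\<close>]
    by (force simp: int_cl_spec_iff intro: spec_le_refl)
qed

lemma int_cl_spec_mono:
  assumes "U \<subseteq> V"
  shows "int_spec X (cl_spec X U) \<subseteq> int_spec X (cl_spec X V)"
  using assms by (fastforce simp: int_cl_spec_iff)

text \<open>The distributive law for regular open sets. A point of \<open>V \<union> W\<close> found
  above some \<open>y\<close> that is itself above \<open>x\<close> in \<open>U\<close> stays in the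
  upset \<open>U\<close>. The other inclusion is monotonicity together with the regularity of
  \<open>U\<close>.\<close>

lemma int_cl_spec_distrib:
  assumes "openin X U" "U \<in> RO X"
  shows "U \<inter> int_spec X (cl_spec X (V \<union> W)) = int_spec X (cl_spec X ((U \<inter> V) \<union> (U \<inter> W)))"
proof
  show "U \<inter> int_spec X (cl_spec X (V \<union> W)) \<subseteq> int_spec X (cl_spec X ((U \<inter> V) \<union> (U \<inter> W)))"
  proof
    fix x assume "x \<in> U \<inter> int_spec X (cl_spec X (V \<union> W))"
    then have x: "x \<in> U" "x \<in> topspace X"
      and VW: "\<And>y. \<lbrakk>y \<in> topspace X; spec_le X x y\<rbrakk> \<Longrightarrow>
        \<exists>z\<in>topspace X. spec_le X y z \<and> z \<in> V \<union> W"
      by (simp_all add: int_cl_spec_iff)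
    have "\<exists>z\<in>topspace X. spec_le X y z \<and> z \<in> (U \<inter> V) \<union> (U \<inter> W)"
      if y: "y \<in> topspace X" "spec_le X x y" for y
    proof -
      obtain z where z: "z \<in> topspace X" "spec_le X y z" "z \<in> V \<union> W"
        using VW[OF y] by blast
      moreover have "z \<in> U"
        using openin_spec_le[OF assms(1) x(1)] spec_le_trans[OF y(2) z(2)] by blast
      ultimately show ?thesis
        by blast
    qed
    then show "x \<in> int_spec X (cl_spec X ((U \<inter> V) \<union> (U \<inter> W)))"
      using x by (simp add: int_cl_spec_iff)
  qed
  have "int_spec X (cl_spec X ((U \<inter> V) \<union> (U \<inter> W))) \<subseteq> int_spec X (cl_spec X U)"
    by (rule int_cl_spec_mono) auto
  moreover have "int_spec X (cl_spec X ((U \<inter> V) \<union> (U \<inter> W))) \<subseteq> int_spec X (cl_spec X (V \<union> W))"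
    by (rule int_cl_spec_mono) auto
  ultimately show "int_spec X (cl_spec X ((U \<inter> V) \<union> (U \<inter> W))) \<subseteq> U \<inter> int_spec X (cl_spec X (V \<union> W))"
    using assms(2) by (auto simp: RO_def)
qed


subsection \<open>Spaces homeomorphic to the space of filters\<close>

text \<open>A copy of \<open>UV L\<close>: \<open>h x\<close> is the filter represented by
  \<open>x\<close>, and the second axiom transports the description of open sets in
  \<open>openin_UV_iff\<close> along \<open>h\<close>.\<close>

locale filter_space = boolean_lattice L for L (structure) +
  fixes X :: "'b topology" and h :: "'b \<Rightarrow> 'a set"
  assumes bij: "bij_betw h (topspace X) {F. proper_filter L F}"
    and openin_iff: "openin X W \<longleftrightarrow> W \<subseteq> topspace X \<and>
      (\<forall>x\<in>W. \<exists>a\<in>carrier L. a \<in> h x \<and> {y \<in> topspace X. a \<in> h y} \<subseteq> W)"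
begin

section \<open>Dual sets and the specialization order\<close>

definition dual :: "'a \<Rightarrow> 'b set" where
  "dual a = {x \<in> topspace X. a \<in> h x}"

lemma proper: "x \<in> topspace X \<Longrightarrow> proper_filter L (h x)"
  using bij_betwE[OF bij] by blast

lemma point:
  assumes "proper_filter L F"
  obtains x where "x \<in> topspace X" "h x = F"
proof -
  have "F \<in> h ` topspace X"
    using bij_betw_imp_surj_on[OF bij] assms by simp
  then show thesis
    using that by blast
qed

lemma dual_subset: "dual a \<subseteq> topspace X"
  by (auto simp: dual_def)

lemma openin_dual: "a \<in> carrier L \<Longrightarrow> openin X (dual a)"
  by (auto simp: openin_iff dual_def)

lemma openin_basis: "\<lbrakk>openin X W; x \<in> W\<rbrakk> \<Longrightarrow> \<exists>a\<in>carrier L. x \<in> dual a \<and> dual a \<subseteq> W"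
proof -
  assume W: "openin X W" "x \<in> W"
  then have "\<exists>a\<in>carrier L. a \<in> h x \<and> {y \<in> topspace X. a \<in> h y} \<subseteq> W"
    using openin_iff[of W] by simp
  moreover have "x \<in> topspace X"
    using W openin_subset by fast
  ultimately show ?thesis
    by (simp add: dual_def)
qed

lemma dual_meet: "\<lbrakk>a \<in> carrier L; b \<in> carrier L\<rbrakk> \<Longrightarrow> dual (a \<sqinter> b) = dual a \<inter> dual b"
  using proper proper_filter_meet_iff by (auto simp: dual_def)

lemma dual_mono: "\<lbrakk>b \<in> carrier L; a \<sqsubseteq> b\<rbrakk> \<Longrightarrow> dual a \<subseteq> dual b"
  using proper proper_filter_up by (auto simp: dual_def)

lemma dual_bottom: "dual \<bottom> = {}"
  using proper proper_filter_bottom by (auto simp: dual_def)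

lemma dual_top: "dual \<top> = topspace X"
  using proper proper_filter_top by (auto simp: dual_def)

text \<open>The basic open sets around \<open>x\<close> are the sets \<open>dual a\<close> with
  \<open>a\<close> in \<open>h x\<close>, and a basis determines the specialization order.\<close>

lemma spec_le_iff:
  assumes "x \<in> topspace X" "y \<in> topspace X"
  shows "spec_le X x y \<longleftrightarrow> h x \<subseteq> h y"
proof
  assume le: "spec_le X x y"
  show "h x \<subseteq> h y"
  proof
    fix a assume "a \<in> h x"
    then have "a \<in> carrier L" "x \<in> dual a"
      using assms proper proper_filter_subset by (auto simp: dual_def)
    then show "a \<in> h y"
      using openin_spec_le[OF openin_dual _ le] by (auto simp: dual_def)
  qed
next
  assume "h x \<subseteq> h y"
  then show "spec_le X x y"
    unfolding spec_le_def using assms openin_basis by (fastforce simp: dual_def)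
qed

text \<open>If \<open>c\<close> is missing from \<open>h x\<close>, the filter extending
  \<open>h x\<close> by \<open>a\<close> is a point above \<open>x\<close> inside
  \<open>dual a\<close>. Conversely, a point of \<open>dual a\<close> above a point of
  \<open>dual c\<close> would have \<open>a \<sqinter> c = \<bottom>\<close> in its filter.\<close>

lemma int_spec_compl_dual:
  assumes "a \<in> carrier L" "c \<in> carrier L" "a \<sqinter> c = \<bottom>" "a \<squnion> c = \<top>"
  shows "int_spec X (topspace X - dual a) = dual c"
proof (intro equalityI subsetI)
  fix x assume x: "x \<in> int_spec X (topspace X - dual a)"
  then have xX: "x \<in> topspace X"
    using int_spec_subset by fast
  show "x \<in> dual c"
  proof (rule ccontr)
    assume "x \<notin> dual c"
    then have "c \<notin> h x"
      using xX by (simp add: dual_def)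
    then obtain G where G: "proper_filter L G" "h x \<subseteq> G" "a \<in> G"
      using proper_filter_extend[OF proper[OF xX] assms(1,2,4)] by metis
    obtain y where "y \<in> topspace X" "h y = G"
      using point G(1) by blast
    then show False
      using x xX G by (auto simp: int_spec_def dual_def spec_le_iff)
  qed
next
  fix x assume x: "x \<in> dual c"
  have "y \<notin> dual a" if "y \<in> topspace X" "spec_le X x y" for y
  proof
    assume "y \<in> dual a"
    moreover have "y \<in> dual c"
      using openin_spec_le openin_dual assms(2) x that(2) by metis
    ultimately have "y \<in> dual \<bottom>"
      using dual_meet[OF assms(1,2)] assms(3) by simp
    then show False
      by (simp add: dual_bottom)
  qed
  then show "x \<in> int_spec X (topspace X - dual a)"
    using x by (auto simp: int_spec_def dual_def)
qed

text \<open>Being a complement is symmetric, so the same \<open>c\<close> serves in both directions;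
  \<open>dual a\<close> is thus its own double pseudocomplement.\<close>

lemma ex_compl:
  assumes "a \<in> carrier L"
  obtains c where "c \<in> carrier L" "int_spec X (topspace X - dual a) = dual c"
    "int_spec X (topspace X - dual c) = dual a"
proof -
  obtain c where c: "c \<in> carrier L" "a \<sqinter> c = \<bottom>" "a \<squnion> c = \<top>"
    using complement_exists assms by blast
  then have "c \<sqinter> a = \<bottom>" "c \<squnion> a = \<top>"
    by (simp_all add: meet_comm join_comm)
  then show thesis
    using that c assms int_spec_compl_dual by metis
qed

section \<open>Dual sets as the compact open regular open sets\<close>

lemma dual_in_RO:
  assumes "a \<in> carrier L"
  shows "dual a \<in> RO X"
  using ex_compl[OF assms] unfolding RO_def int_spec_cl_spec
  by (metis (mono_tags, lifting) dual_subset mem_Collect_eq)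

lemma compactin_dual:
  assumes a: "a \<in> carrier L"
  shows "compactin X (dual a)"
\<comment> \<open>The principal filter of bottom is not proper and gives no point, but then the dual
  set is empty.\<close>
proof (cases "a = \<bottom>")
  case True
  then show ?thesis
    by (simp add: dual_bottom)
next
  case False
  then obtain x where x: "x \<in> topspace X" "h x = {c \<in> carrier L. a \<sqsubseteq> c}"
    using point proper_filter_principal[OF a] by metis
  \<comment> \<open>A basic neighbourhood \<open>dual b\<close> of \<open>x\<close> has
    \<open>a \<sqsubseteq> b\<close>, hence contains \<open>dual a\<close>. One member of any cover
    therefore covers everything.\<close>
  have least: "dual a \<subseteq> U" if U: "openin X U" "x \<in> U" for U
  proof -
    obtain b where "b \<in> carrier L" "x \<in> dual b" "dual b \<subseteq> U"
      using openin_basis[OF U] by blast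
    then show ?thesis
      using dual_mono x by (fastforce simp: dual_def)
  qed
  have "x \<in> dual a"
    using x a by (simp add: dual_def)
  show ?thesis
    unfolding compactin_def
  proof (intro conjI allI impI)
    fix \<U> assume \<U>: "Ball \<U> (openin X) \<and> dual a \<subseteq> \<Union> \<U>"
    then obtain U where "U \<in> \<U>" "x \<in> U"
      using \<open>x \<in> dual a\<close> by blast
    then show "\<exists>\<F>. finite \<F> \<and> \<F> \<subseteq> \<U> \<and> dual a \<subseteq> \<Union> \<F>"
      using least \<U> by (intro exI[of _ "{U}"]) auto
  qed (rule dual_subset)
qed

text \<open>A union of dual sets need not be a dual set, but its pseudocomplement is: by De Morgan
  it is an intersection of dual sets, and the empty union yields \<open>dual \<top>\<close>.\<close>

lemma int_spec_compl_finite_union: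
  assumes "finite S" "S \<subseteq> carrier L"
  shows "\<exists>c\<in>carrier L. int_spec X (topspace X - \<Union>(dual ` S)) = dual c"
  using assms
proof (induction S)
  case empty
  then show ?case
    by (auto simp: dual_top int_spec_def intro!: bexI[of _ \<top>])
next
  case (insert a S)
  then obtain c d where cd: "c \<in> carrier L" "int_spec X (topspace X - \<Union>(dual ` S)) = dual c"
    "d \<in> carrier L" "int_spec X (topspace X - dual a) = dual d"
    using ex_compl by (metis insert_subset)
  have "int_spec X (topspace X - \<Union>(dual ` insert a S)) =
      int_spec X (topspace X - dual a) \<inter> int_spec X (topspace X - \<Union>(dual ` S))"
    by (auto simp: int_spec_def)
  then show ?case
    using cd dual_meet meet_closed by metis
qed

lemma CORO_eq: "CORO X = dual ` carrier L"
proof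
  show "dual ` carrier L \<subseteq> CORO X"
    using compactin_dual openin_dual dual_in_RO by (auto simp: CORO_def)
  show "CORO X \<subseteq> dual ` carrier L"
  proof
    fix U assume "U \<in> CORO X"
    then have U: "compactin X U" "openin X U" "U = int_spec X (cl_spec X U)"
      by (auto simp: CORO_def RO_def)
    \<comment> \<open>Restricting the cover to dual sets inside \<open>U\<close> makes the finite
      subcover have union exactly \<open>U\<close>.\<close>
    let ?C = "dual ` {a \<in> carrier L. dual a \<subseteq> U}"
    have "U \<subseteq> \<Union>?C"
      using openin_basis[OF U(2)] by blast
    moreover have "openin X V" if "V \<in> ?C" for V
      using that openin_dual by blast
    ultimately have "\<exists>\<F>. finite \<F> \<and> \<F> \<subseteq> ?C \<and> U \<subseteq> \<Union>\<F>"
      by (intro compactinD[OF U(1)])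
    then obtain \<F> where \<F>: "finite \<F>" "\<F> \<subseteq> ?C" "U \<subseteq> \<Union>\<F>"
      by blast
    obtain S where S: "finite S" "S \<subseteq> {a \<in> carrier L. dual a \<subseteq> U}" "\<F> = dual ` S"
      using finite_subset_image[OF \<F>(1,2)] by auto
    have "U = \<Union>(dual ` S)"
      using \<F> S by blast
    then obtain c where c: "c \<in> carrier L" "int_spec X (topspace X - U) = dual c"
      using int_spec_compl_finite_union[of S] S by auto
    \<comment> \<open>By regularity \<open>U\<close> is the pseudocomplement of its pseudocomplement
      \<open>dual c\<close>, so it is \<open>dual d\<close>.\<close>
    obtain d where "d \<in> carrier L" "int_spec X (topspace X - dual c) = dual d"
      using ex_compl c by metis
    then show "U \<in> dual ` carrier L"
      using U(3) c unfolding int_spec_cl_spec by auto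
  qed
qed

section \<open>The UV-space axioms\<close>

lemma proper_filter_CORO:
  assumes F: "proper_filter (CORO_order X) F"
  shows "\<exists>x\<in>topspace X. F = CORO_at X x"
proof -
  have F': "F \<subseteq> CORO X" "F \<noteq> {}" "F \<noteq> CORO X"
    and up: "\<And>U V. \<lbrakk>U \<in> F; V \<in> CORO X; U \<subseteq> V\<rbrakk> \<Longrightarrow> V \<in> F"
    and meet: "\<And>U V. \<lbrakk>U \<in> F; V \<in> F\<rbrakk> \<Longrightarrow> U \<sqinter>\<^bsub>CORO_order X\<^esub> V \<in> F"
    using F by (simp_all add: proper_filter_def CORO_order_def)
  have car: "dual a \<in> CORO X" if "a \<in> carrier L" for a
    using that by (simp add: CORO_eq)
  \<comment> \<open>Pull \<open>F\<close> back along \<open>dual\<close>. The point \<open>x\<close>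
    representing \<open>?G\<close> lies in \<open>dual a\<close> exactly when \<open>dual a\<close>
    is in \<open>F\<close>.\<close>
  let ?G = "{a \<in> carrier L. dual a \<in> F}"
  have "proper_filter L ?G"
  proof (rule proper_filterI)
    show "?G \<noteq> {}"
      using F' by (auto simp: CORO_eq)
    \<comment> \<open>Otherwise the empty set would be in \<open>F\<close>, and upward closure would
      make \<open>F\<close> all of \<open>CORO X\<close>.\<close>
    show "\<bottom> \<notin> ?G"
      using F' up by (auto simp: dual_bottom)
    show "b \<in> ?G" if "a \<in> ?G" "b \<in> carrier L" "a \<sqsubseteq> b" for a b
      using that up car dual_mono by blast
    show "a \<sqinter> b \<in> ?G" if "a \<in> ?G" "b \<in> ?G" for a b
    proof -
      have ab: "a \<in> carrier L" "b \<in> carrier L" "dual a \<in> F" "dual b \<in> F"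
        using that by auto
      then have "dual a \<sqinter>\<^bsub>CORO_order X\<^esub> dual b = dual (a \<sqinter> b)"
        using car dual_meet by (metis meet_CORO_order meet_closed)
      then show ?thesis
        using ab meet by (metis (mono_tags, lifting) mem_Collect_eq meet_closed)
    qed
  qed auto
  then obtain x where "x \<in> topspace X" "h x = ?G"
    using point by blast
  then have "F = CORO_at X x"
    using F'(1) unfolding CORO_at_def CORO_eq by (auto simp: dual_def)
  then show ?thesis
    using \<open>x \<in> topspace X\<close> by blast
qed

lemma t0: "t0_space X"
  unfolding t0_space_def
proof (intro ballI impI)
  fix x y assume xy: "x \<in> topspace X" "y \<in> topspace X" "x \<noteq> y"
  then have "h x \<noteq> h y"
    using bij_betw_imp_inj_on[OF bij] by (simp add: inj_on_eq_iff)
  then obtain a where a: "a \<in> h x \<longleftrightarrow> a \<notin> h y"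
    by blast
  then have "openin X (dual a)"
    using xy proper proper_filter_subset openin_dual by blast
  moreover have "x \<notin> dual a \<longleftrightarrow> y \<in> dual a"
    using a xy by (auto simp: dual_def)
  ultimately show "\<exists>U. openin X U \<and> (x \<notin> U \<longleftrightarrow> y \<in> U)"
    by blast
qed

lemma UV_space: "UV_space X"
  unfolding UV_space_def
proof (intro conjI ballI allI impI)
  show "U \<inter> V \<in> CORO X" if UV: "U \<in> CORO X" "V \<in> CORO X" for U V
  proof -
    obtain a b where "a \<in> carrier L" "b \<in> carrier L" "U = dual a" "V = dual b"
      using UV unfolding CORO_eq by blast
    then show ?thesis
      by (simp add: CORO_eq flip: dual_meet)
  qed
  show "int_spec X (topspace X - U) \<in> CORO X" if U: "U \<in> CORO X" for U
  proof -
    obtain a where a: "a \<in> carrier L" "U = dual a"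
      using U unfolding CORO_eq by blast
    then show ?thesis
      using ex_compl[OF a(1)] by (metis CORO_eq image_eqI)
  qed
  show "openin X = arbitrary union_of (\<lambda>U. U \<in> CORO X)"
  proof
    fix W
    show "openin X W = (arbitrary union_of (\<lambda>U. U \<in> CORO X)) W"
      unfolding arbitrary_union_of_alt
    proof (intro iffI ballI)
      fix x assume "openin X W" "x \<in> W"
      then obtain a where "a \<in> carrier L" "x \<in> dual a" "dual a \<subseteq> W"
        using openin_basis by metis
      then show "\<exists>U. U \<in> CORO X \<and> x \<in> U \<and> U \<subseteq> W"
        unfolding CORO_eq by blast
    next
      assume "\<forall>x\<in>W. \<exists>U. U \<in> CORO X \<and> x \<in> U \<and> U \<subseteq> W"
      then show "openin X W"
        by (subst openin_subopen) (auto simp: CORO_def)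
    qed
  qed
qed (simp_all add: t0 proper_filter_CORO)

end

text \<open>Serves both parts: the identity on \<open>UV A\<close> gives the first, and
  \<open>L = CORO_order X\<close> gives the forward direction of the second.\<close>

lemma UV_space_if_homeomorphic:
  assumes L: "boolean_lattice L" and hom: "X homeomorphic_space UV L"
  shows "UV_space X"
proof -
  obtain h where h: "homeomorphic_map X (UV L) h"
    using hom by (auto simp: homeomorphic_space)
  then have inj: "inj_on h (topspace X)" and im: "h ` topspace X = {F. proper_filter L F}"
    by (auto simp: homeomorphic_eq_everything_map topspace_UV)
  have proper: "proper_filter L (h x)" if "x \<in> topspace X" for x
    using im that by blast
  interpret filter_space L X h
  proof (intro filter_space.intro filter_space_axioms.intro)
    show "bij_betw h (topspace X) {F. proper_filter L F}"
      using inj im by (simp add: bij_betw_def)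
    fix W
    show "openin X W \<longleftrightarrow> W \<subseteq> topspace X \<and>
        (\<forall>x\<in>W. \<exists>a\<in>carrier L. a \<in> h x \<and> {y \<in> topspace X. a \<in> h y} \<subseteq> W)"
    proof (cases "W \<subseteq> topspace X")
      case True
      \<comment> \<open>Since \<open>h\<close> is injective, inclusion of basic sets can be tested
        before applying \<open>h\<close>; this turns openness in \<open>UV L\<close> into the
        locale's condition.\<close>
      have hat: "hat L a \<subseteq> h ` W \<longleftrightarrow> {y \<in> topspace X. a \<in> h y} \<subseteq> W" for a
      proof -
        have "hat L a = h ` {y \<in> topspace X. a \<in> h y}"
          unfolding hat_def using equalityD2[OF im] proper by blast
        then show ?thesis
          using inj True by (simp add: inj_on_image_subset_iff)
      qed
      have "openin X W \<longleftrightarrow> openin (UV L) (h ` W)"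
        using homeomorphic_map_openness_eq[OF h] True by auto
      also have "\<dots> \<longleftrightarrow> (\<forall>x\<in>W. \<exists>a\<in>carrier L. h x \<in> hat L a \<and> hat L a \<subseteq> h ` W)"
        by (simp add: boolean_lattice.openin_UV_iff[OF L])
      also have "\<dots> \<longleftrightarrow> (\<forall>x\<in>W. \<exists>a\<in>carrier L. a \<in> h x \<and> {y \<in> topspace X. a \<in> h y} \<subseteq> W)"
        unfolding hat using True proper by (auto simp: hat_def)
      finally show ?thesis
        using True by simp
    next
      case False
      then show ?thesis
        using openin_subset by blast
    qed
  qed (rule L)
  show ?thesis
    by (rule UV_space)
qed


subsection \<open>The Boolean lattice of a UV-space\<close>

lemma CORO_order_simps [simp]:
  "carrier (CORO_order X) = CORO X"
  "U \<sqsubseteq>\<^bsub>CORO_order X\<^esub> V \<longleftrightarrow> U \<subseteq> V"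
  "(.=\<^bsub>CORO_order X\<^esub>) = (=)"
  by (simp_all add: CORO_order_def)

lemma CORO_subset: "U \<in> CORO X \<Longrightarrow> U \<subseteq> topspace X"
  by (simp add: CORO_def RO_def)

lemma empty_in_CORO: "{} \<in> CORO X"
  by (auto simp: CORO_def RO_def int_spec_def cl_spec_def intro: spec_le_refl)

context
  fixes X :: "'b topology"
  assumes UV: "UV_space X"
begin

lemma CORO_Int: "\<lbrakk>U \<in> CORO X; V \<in> CORO X\<rbrakk> \<Longrightarrow> U \<inter> V \<in> CORO X"
  using UV by (simp add: UV_space_def)

lemma CORO_compl: "U \<in> CORO X \<Longrightarrow> int_spec X (topspace X - U) \<in> CORO X"
  using UV by (simp add: UV_space_def)

text \<open>The whole space is the pseudocomplement of the empty set. In particular, a UV-space is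
  compact.\<close>

lemma topspace_in_CORO: "topspace X \<in> CORO X"
  using CORO_compl[OF empty_in_CORO] by (simp add: int_spec_def)

text \<open>De Morgan expresses the double pseudocomplement of a union through intersection and
  pseudocomplement, the two operations under which \<open>CORO X\<close> is closed.\<close>

lemma CORO_join:
  assumes "U \<in> CORO X" "V \<in> CORO X"
  shows "int_spec X (cl_spec X (U \<union> V)) \<in> CORO X"
proof -
  have "int_spec X (topspace X - (U \<union> V)) =
      int_spec X (topspace X - U) \<inter> int_spec X (topspace X - V)"
    by (auto simp: int_spec_def)
  then show ?thesis
    using assms CORO_compl CORO_Int by (simp add: int_spec_cl_spec)
qed

lemma CORO_basis:
  assumes "openin X W" "x \<in> W"
  obtains U where "U \<in> CORO X" "x \<in> U" "U \<subseteq> W"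
proof -
  have "(arbitrary union_of (\<lambda>U. U \<in> CORO X)) W"
    using UV assms by (simp add: UV_space_def)
  then show thesis
    using assms that unfolding arbitrary_union_of_alt by blast
qed

text \<open>A regular open \<open>W\<close> containing the union is fixed by the monotone operator
  \<open>int_spec X (cl_spec X _)\<close>, hence contains its value at the union.\<close>

lemma join_least:
  assumes "U \<in> CORO X" "V \<in> CORO X"
  shows "least (CORO_order X) (int_spec X (cl_spec X (U \<union> V))) (Upper (CORO_order X) {U, V})"
proof -
  have up: "Upper (CORO_order X) {U, V} = {W \<in> CORO X. U \<union> V \<subseteq> W}"
    using assms by (auto simp: Upper_def)
  have "openin X (U \<union> V)"
    using assms by (auto simp: CORO_def)
  moreover have "int_spec X (cl_spec X (U \<union> V)) \<subseteq> W" if "W \<in> CORO X" "U \<union> V \<subseteq> W" for W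
    using int_cl_spec_mono[OF that(2), of X] that(1) by (auto simp: CORO_def RO_def)
  ultimately show ?thesis
    using CORO_join[OF assms] openin_subset_int_cl_spec[of X "U \<union> V"]
    unfolding least_def up by auto
qed

lemma meet_greatest:
  assumes "U \<in> CORO X" "V \<in> CORO X"
  shows "greatest (CORO_order X) (U \<inter> V) (Lower (CORO_order X) {U, V})"
  using assms CORO_Int by (auto simp: greatest_def Lower_def)

text \<open>Once the lattice operations are identified with intersection and regularized union,
  distributivity is \<open>int_cl_spec_distrib\<close> and the complement is the
  pseudocomplement.\<close>

lemma boolean_lattice_CORO: "boolean_lattice (CORO_order X)"
proof -
  interpret po: partial_order "CORO_order X"
    by unfold_locales auto
  interpret bounded_lattice "CORO_order X"
  proof
    show "\<exists>S. least (CORO_order X) S (Upper (CORO_order X) {U, V})"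
      if "U \<in> carrier (CORO_order X)" "V \<in> carrier (CORO_order X)" for U V
      using that join_least by (auto intro!: exI)
    show "\<exists>S. greatest (CORO_order X) S (Lower (CORO_order X) {U, V})"
      if "U \<in> carrier (CORO_order X)" "V \<in> carrier (CORO_order X)" for U V
      using that meet_greatest by (auto intro!: exI)
    show "\<exists>S. least (CORO_order X) S (carrier (CORO_order X))"
      using empty_in_CORO by (intro exI[of _ "{}"]) (auto simp: least_def)
    show "\<exists>S. greatest (CORO_order X) S (carrier (CORO_order X))"
      using topspace_in_CORO CORO_subset by (intro exI[of _ "topspace X"]) (auto simp: greatest_def)
  qed
  have meet: "U \<sqinter>\<^bsub>CORO_order X\<^esub> V = U \<inter> V" if "U \<in> CORO X" "V \<in> CORO X" for U V
    using that CORO_Int meet_CORO_order by blast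
  have join: "U \<squnion>\<^bsub>CORO_order X\<^esub> V = int_spec X (cl_spec X (U \<union> V))"
    if "U \<in> CORO X" "V \<in> CORO X" for U V
  proof (rule joinI)
    fix W assume "least (CORO_order X) W (Upper (CORO_order X) {U, V})"
    then show "W = int_spec X (cl_spec X (U \<union> V))"
      using join_least[OF that] by (rule po.least_unique)
  qed (use that in auto)
  have bot: "\<bottom>\<^bsub>CORO_order X\<^esub> = {}"
    by (rule bottom_eq[symmetric]) (simp_all add: empty_in_CORO)
  have top: "\<top>\<^bsub>CORO_order X\<^esub> = topspace X"
    by (rule top_eq[symmetric]) (simp_all add: topspace_in_CORO CORO_subset)
  show ?thesis
  proof
    fix U V W
    assume "U \<in> carrier (CORO_order X)" "V \<in> carrier (CORO_order X)" "W \<in> carrier (CORO_order X)"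
    then have UVW: "U \<in> CORO X" "V \<in> CORO X" "W \<in> CORO X"
      by auto
    then have "openin X U" "U \<in> RO X"
      by (auto simp: CORO_def)
    then show "U \<sqinter>\<^bsub>CORO_order X\<^esub> (V \<squnion>\<^bsub>CORO_order X\<^esub> W) =
        U \<sqinter>\<^bsub>CORO_order X\<^esub> V \<squnion>\<^bsub>CORO_order X\<^esub> (U \<sqinter>\<^bsub>CORO_order X\<^esub> W)"
      using UVW by (simp add: meet join CORO_Int CORO_join int_cl_spec_distrib)
  next
    fix U assume "U \<in> carrier (CORO_order X)"
    then have U: "U \<in> CORO X"
      by simp
    let ?N = "int_spec X (topspace X - U)"
    have "U \<inter> ?N = {}"
      by (auto simp: int_spec_def intro: spec_le_refl)
    moreover have "int_spec X (cl_spec X (U \<union> ?N)) = topspace X"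
    proof (intro equalityI subsetI)
      fix x assume x: "x \<in> topspace X"
      \<comment> \<open>Either \<open>y\<close> is in \<open>?N\<close>, or failing that some point
        above \<open>y\<close> is in \<open>U\<close>; so \<open>U \<union> ?N\<close> is
        dense.\<close>
      have "\<exists>z\<in>topspace X. spec_le X y z \<and> z \<in> U \<union> ?N" if "y \<in> topspace X" for y
        using that by (cases "y \<in> ?N") (auto simp: int_spec_def intro: spec_le_refl)
      then show "x \<in> int_spec X (cl_spec X (U \<union> ?N))"
        using x by (auto simp: int_cl_spec_iff)
    qed (use int_spec_subset in fast)
    ultimately show "\<exists>V\<in>carrier (CORO_order X). U \<sqinter>\<^bsub>CORO_order X\<^esub> V = \<bottom>\<^bsub>CORO_order X\<^esub> \<and>
        U \<squnion>\<^bsub>CORO_order X\<^esub> V = \<top>\<^bsub>CORO_order X\<^esub>"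
      using U CORO_compl by (intro bexI[of _ ?N]) (simp_all add: meet join bot top)
  qed
qed

section \<open>A UV-space as the space of filters of its own algebra\<close>

lemma proper_filter_CORO_at:
  assumes "x \<in> topspace X"
  shows "proper_filter (CORO_order X) (CORO_at X x)"
  unfolding proper_filter_def
proof (intro conjI ballI impI)
  show "CORO_at X x \<noteq> {}"
    using assms topspace_in_CORO by (auto simp: CORO_at_def)
  show "CORO_at X x \<noteq> carrier (CORO_order X)"
    using empty_in_CORO by (auto simp: CORO_at_def)
  show "U \<sqinter>\<^bsub>CORO_order X\<^esub> V \<in> CORO_at X x" if "U \<in> CORO_at X x" "V \<in> CORO_at X x" for U V
    using that CORO_Int by (auto simp: CORO_at_def meet_CORO_order)
qed (auto simp: CORO_at_def)

text \<open>Surjectivity is the filter condition of a UV-space, injectivity comes from T0 and the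
  basis, and the basic open sets of the two spaces correspond.\<close>

lemma homeomorphic_map_CORO_at: "homeomorphic_map X (UV (CORO_order X)) (CORO_at X)"
proof -
  have im: "CORO_at X ` topspace X = topspace (UV (CORO_order X))"
    using UV proper_filter_CORO_at by (auto simp: topspace_UV UV_space_def)
  have inj: "inj_on (CORO_at X) (topspace X)"
  proof (rule inj_onI, rule ccontr)
    fix x y assume xy: "x \<in> topspace X" "y \<in> topspace X" "CORO_at X x = CORO_at X y" "x \<noteq> y"
    have "t0_space X"
      using UV by (simp add: UV_space_def)
    then obtain W where W: "openin X W" "x \<notin> W \<longleftrightarrow> y \<in> W"
      using xy(1,2,4) by (auto simp: t0_space_def)
    \<comment> \<open>Membership in an open set depends only on \<open>CORO_at X z\<close>, so equal
      values contradict separation by \<open>W\<close>.\<close>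
    have "z \<in> W \<longleftrightarrow> (\<exists>U\<in>CORO_at X z. U \<subseteq> W)" for z
    proof
      assume "z \<in> W"
      then obtain U where "U \<in> CORO X" "z \<in> U" "U \<subseteq> W"
        using CORO_basis[OF W(1)] by metis
      then show "\<exists>U\<in>CORO_at X z. U \<subseteq> W"
        by (auto simp: CORO_at_def)
    qed (auto simp: CORO_at_def)
    then have "x \<in> W \<longleftrightarrow> y \<in> W"
      using xy(3) by simp
    then show False
      using W(2) by blast
  qed
  \<comment> \<open>This matching of basic open sets yields both openness and continuity of the
    map.\<close>
  have hat: "hat (CORO_order X) U = CORO_at X ` U" if "U \<in> CORO X" for U
  proof -
    have "hat (CORO_order X) U = {F \<in> CORO_at X ` topspace X. U \<in> F}"
      by (auto simp: im topspace_UV hat_def)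
    then show ?thesis
      using that CORO_subset[OF that] by (auto simp: CORO_at_def)
  qed
  have "openin (UV (CORO_order X)) (CORO_at X ` W)" if W: "openin X W" for W
    unfolding boolean_lattice.openin_UV_iff[OF boolean_lattice_CORO]
  proof
    fix F assume "F \<in> CORO_at X ` W"
    then obtain x where x: "x \<in> W" "F = CORO_at X x"
      by blast
    obtain U where "U \<in> CORO X" "x \<in> U" "U \<subseteq> W"
      using CORO_basis[OF W x(1)] by blast
    then show "\<exists>U\<in>carrier (CORO_order X).
        F \<in> hat (CORO_order X) U \<and> hat (CORO_order X) U \<subseteq> CORO_at X ` W"
      using x by (intro bexI[of _ U]) (auto simp: hat)
  qed
  moreover have "openin X {x \<in> topspace X. CORO_at X x \<in> \<V>}" if \<V>: "openin (UV (CORO_order X)) \<V>" for \<V>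
  proof (subst openin_subopen, intro ballI)
    fix x assume x: "x \<in> {x \<in> topspace X. CORO_at X x \<in> \<V>}"
    then obtain U where U: "U \<in> CORO X" "CORO_at X x \<in> hat (CORO_order X) U"
      "hat (CORO_order X) U \<subseteq> \<V>"
      using \<V> boolean_lattice.openin_UV_iff[OF boolean_lattice_CORO] by auto
    then have "x \<in> U"
      by (simp add: hat_def CORO_at_def)
    moreover have "U \<subseteq> {x \<in> topspace X. CORO_at X x \<in> \<V>}"
      using U CORO_subset hat by blast
    ultimately show "\<exists>T. openin X T \<and> x \<in> T \<and> T \<subseteq> {x \<in> topspace X. CORO_at X x \<in> \<V>}"
      using U(1) by (auto simp: CORO_def)
  qed
  ultimately show ?thesis
    using im inj
    by (intro bijective_open_imp_homeomorphic_map) (auto simp: continuous_map open_map_def)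
qed

end

theorem theorem5p4:
  fixes A :: "'a gorder" and X :: "'b topology"
  assumes "boolean_lattice A"
  shows "UV_space (UV A) \<and>
    ((boolean_lattice (CORO_order X) \<and> X homeomorphic_space UV (CORO_order X)) \<longleftrightarrow> UV_space X)"
  using UV_space_if_homeomorphic[OF assms homeomorphic_space_refl]
    UV_space_if_homeomorphic[of "CORO_order X" X] boolean_lattice_CORO[of X]
    homeomorphic_map_CORO_at[of X] homeomorphic_map_imp_homeomorphic_space
  by blast

end
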